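(* Let $T$ be an ergodic measure preserving automorphism of a standard probability space $(X,\mathcal{S},\mu)$, let $d\geq1$, and let $f\colon X\to\mathbb{R}^d$ be a Borel map. Suppose that either the distributions (under $\mu$) of the random variables $\mathbf{f}(n,\cdot)/n^{1/d}$, $n\geq1$, are uniformly tight, or there exist $\varepsilon,K>0$ such that $\mu(\{x\in X:\|\mathbf{f}(n,x)/n^{1/d}\|\leq K\})>\varepsilon$ for every $n\geq1$. Then the map $\tilde f\colon X\times X\to\mathbb{R}^d$, $\tilde f(x,y)=f(x)-f(y)$, is recurrent with respect to the automorphism $S=T\times T$ of $(X\times X,\mathcal{S}\otimes\mathcal{S},\mu\times\mu)$.
   Context: For a measure preserving automorphism $T$ of a probability space $(X,\mathcal{S},\mu)$ and a Borel map $f\colon X\to\mathbb{R}^d$, the cocycle $\mathbf{f}\colon\mathbb{Z}\times X\to\mathbb{R}^d$ is defined by $\mathbf{f}(n,x)=f(T^{n-1}x)+\dots+f(x)$ for $n>0$, $\mathbf{f}(0,x)=0$, and $\mathbf{f}(n,x)=-\mathbf{f}(-n,T^nx)$ for $n<0$. The function $f$ is called recurrent if $\liminf_{n\to\infty}\|\mathbf{f}(n,x)\|=0$ for $\mu$-a.e. $x\in X$; here $\|\cdot\|$ denotes the maximum norm on $\mathbb{R}^d$ (recurrence does not depend on the choice of norm). For $\tilde f$ and $S=T\times T$ the cocycle $\tilde{\mathbf{f}}$ is defined by the same formula with $S,\tilde f$ in place of $T,f$, and recurrence of $\tilde f$ means $\liminf_{n\to\infty}\|\tilde{\mathbf{f}}(n,(x,y))\|=0$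 for $(\mu\times\mu)$-a.e. $(x,y)$. *)

theory Defs
  imports "HOL-Probability.Probability"
begin

definition measure_preserving :: "'a measure \<Rightarrow> ('a \<Rightarrow> 'a) \<Rightarrow> bool" where
  "measure_preserving M T \<longleftrightarrow> T \<in> M \<rightarrow>\<^sub>M M \<and> distr M M T = M"

definition mp_automorphism :: "'a measure \<Rightarrow> ('a \<Rightarrow> 'a) \<Rightarrow> bool" where
  "mp_automorphism M T \<longleftrightarrow>
     bij_betw T (space M) (space M) \<and>
     measure_preserving M T \<and>
     measure_preserving M (inv_into (space M) T)"

definition ergodic :: "'a measure \<Rightarrow> ('a \<Rightarrow> 'a) \<Rightarrow> bool" where
  "ergodic M T \<longleftrightarrow>
     (\<forall>A\<in>sets M. T -` A \<inter> space M = A \<longrightarrow> emeasure M A = 0 \<or> emeasure M A = 1)"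

text \<open>The cocycle f(n,x) = f(T^(n-1) x) + ... + f(x) for n >= 0
  (only nonnegative times are needed in the statement).\<close>
definition cocycle :: "('a \<Rightarrow> 'a) \<Rightarrow> ('a \<Rightarrow> 'b::comm_monoid_add) \<Rightarrow> nat \<Rightarrow> 'a \<Rightarrow> 'b" where
  "cocycle T f n x = (\<Sum>k<n. f ((T ^^ k) x))"

definition maxnorm :: "real ^ 'n::finite \<Rightarrow> real" where
  "maxnorm v = Max (range (\<lambda>i. \<bar>v $ i\<bar>))"

definition recurrent :: "'a measure \<Rightarrow> ('a \<Rightarrow> 'a) \<Rightarrow> ('a \<Rightarrow> real ^ 'n::finite) \<Rightarrow> bool" where
  "recurrent M T f \<longleftrightarrow>
     (AE x in M. liminf (\<lambda>n. ereal (maxnorm (cocycle T f n x))) = 0)"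

definition uniformly_tight :: "'a measure \<Rightarrow> (nat \<Rightarrow> 'a \<Rightarrow> real ^ 'n::finite) \<Rightarrow> bool" where
  "uniformly_tight M g \<longleftrightarrow>
     (\<forall>e>0. \<exists>K. compact K \<and> (\<forall>n\<ge>1. measure (distr M borel (g n)) K > 1 - e))"

end

theory Submission
  imports Defs
begin

text \<open>Write \<open>F n (x, y)\<close> for the difference of the cocycles at \<open>x\<close> and \<open>y\<close>. Cutting
  the cube of radius \<open>K n\<^bsup>1/d\<^esup>\<close> into cells of side \<open>r\<close> and applying Cauchy-Schwarz to the cell
  probabilities shows that \<open>|F n| \<le> r\<close> has probability at least \<open>b r\<^sup>d / n\<close> for \<open>n \<ge> r\<^sup>d\<close>, and
  these bounds sum to a logarithmically large multiple of \<open>r\<^sup>d\<close>.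

  If \<open>F\<close> is not recurrent, some set \<open>C\<close> of positive measure satisfies \<open>|F n| > s\<close> on \<open>C\<close> for all
  \<open>n \<ge> N\<close>. Along an orbit the values of \<open>F\<close> at visits to \<open>C\<close> are then separated, so at most
  \<open>c r\<^sup>d\<close> of them lie in any ball of radius \<open>r\<close>. This bound carries over from \<open>C\<close> to a set of
  measure arbitrarily close to 1 with the constant \<open>c\<close> changing only by a fixed factor: although
  \<open>T \<times> T\<close> need not be ergodic, the maps \<open>T \<times> id\<close> and \<open>id \<times> T\<close> together are, and they change \<open>F\<close>
  only by a coboundary. By the mean ergodic theorem suitable averages of the indicator of \<open>C\<close> over
  their compositions exceed half the measure of \<open>C\<close> outside a small set, and a shift
  by boundedly many steps costs a displacement that is negligible for large \<open>r\<close>. Comparing both estimates of the expected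
  number of visits contradicts the logarithmic divergence.\<close>

subsection \<open>Grids and pigeonhole estimates\<close>

lemma maxnorm_eq_infnorm: "maxnorm v = infnorm v"
proof -
  have "{\<bar>v $ i\<bar> |i. i \<in> UNIV} = range (\<lambda>i. \<bar>v $ i\<bar>)"
    by auto
  then show ?thesis
    by (simp add: maxnorm_def infnorm_cart cSup_eq_Max)
qed

lemma infnorm_le_iff_cart:
  fixes v :: "real ^ 'n::finite"
  shows "infnorm v \<le> R \<longleftrightarrow> (\<forall>i. \<bar>v $ i\<bar> \<le> R)"
  by (simp add: maxnorm_eq_infnorm[symmetric] maxnorm_def)

lemma borel_measurable_infnorm [measurable]:
  "(infnorm :: 'b::euclidean_space \<Rightarrow> real) \<in> borel_measurable borel"
  by (intro borel_measurable_continuous_onI continuous_at_imp_continuous_on ballI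
      continuous_infnorm continuous_ident)

definition grid_cell :: "real \<Rightarrow> real ^ 'n::finite \<Rightarrow> 'n \<Rightarrow> int" where
  "grid_cell s v = (\<lambda>i. \<lfloor>v $ i / s\<rfloor>)"

text \<open>The indices of the cells that meet the cube of radius \<open>R\<close> about the origin.
  Writing them as an extensional product lets \<open>finite_PiE\<close> and \<open>card_PiE\<close>
  count them.\<close>

definition grid_box :: "real \<Rightarrow> real \<Rightarrow> ('n::finite \<Rightarrow> int) set" where
  "grid_box s R = (UNIV \<rightarrow>\<^sub>E {\<lfloor>- R / s\<rfloor>..\<lfloor>R / s\<rfloor>})"

lemma finite_grid_box [simp]: "finite (grid_box s R)"
  by (simp add: grid_box_def finite_PiE)

lemma card_grid_box_le:
  assumes "s > 0" "R \<ge> 0"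
  shows "real (card (grid_box s R :: ('n::finite \<Rightarrow> int) set)) \<le> (2 * R / s + 2) ^ CARD('n)"
proof -
  have "R / s \<ge> 0"
    using assms by simp
  then have "real (card {\<lfloor>- R / s\<rfloor>..\<lfloor>R / s\<rfloor>}) \<le> 2 * R / s + 2"
    by simp linarith
  then show ?thesis
    by (simp add: grid_box_def card_PiE power_mono)
qed

lemma grid_cell_in_box:
  assumes "s > 0" "infnorm v \<le> R"
  shows "grid_cell s v \<in> grid_box s R"
proof -
  have "- R / s \<le> v $ i / s" "v $ i / s \<le> R / s" for i
    using assms component_le_infnorm_cart[of v i] by (intro divide_right_mono; linarith)+
  then show ?thesis
    by (auto simp: grid_cell_def grid_box_def intro!: floor_mono)
qed

lemma infnorm_diff_le_same_cell:
  assumes "s > 0" "grid_cell s v = grid_cell s w"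
  shows "infnorm (v - w) \<le> s"
  unfolding infnorm_le_iff_cart
proof
  fix i
  have "\<lfloor>v $ i / s\<rfloor> = \<lfloor>w $ i / s\<rfloor>"
    using fun_cong[OF assms(2), of i] by (simp add: grid_cell_def)
  then have "\<bar>v $ i / s - w $ i / s\<bar> \<le> 1"
    by linarith
  then show "\<bar>(v - w) $ i\<bar> \<le> s"
    using assms(1) by (simp add: diff_divide_distrib[symmetric])
qed

lemma measurable_grid_cell_eq [measurable]:
  fixes g :: "'a \<Rightarrow> real ^ 'n::finite"
  assumes [measurable]: "g \<in> borel_measurable M"
  shows "Measurable.pred M (\<lambda>x. grid_cell s (g x) = b)"
proof -
  have [measurable]: "(\<lambda>v::real ^ 'n. v $ i) \<in> borel_measurable borel" for i :: 'n
    by (intro borel_measurable_continuous_onI continuous_intros)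
  show ?thesis
    unfolding grid_cell_def fun_eq_iff by measurable
qed

text \<open>Two values in the same cell of side \<open>s\<close> are within \<open>s\<close> of each
  other, so by \<open>sep\<close> their times differ by less than \<open>N\<close>. Each cell is
  thus used by at most \<open>N\<close> times, and only cells of the box about \<open>q\<close>
  occur. The centre \<open>q\<close> is arbitrary because it moves in the later induction over
  averages.\<close>

lemma card_separated_le:
  fixes a :: "nat \<Rightarrow> real ^ 'n::finite"
  assumes "s > 0" "R \<ge> 0" "finite V"
    and sep: "\<And>m n. m \<in> V \<Longrightarrow> n \<in> V \<Longrightarrow> m + N \<le> n \<Longrightarrow> infnorm (a n - a m) > s"
    and near: "\<And>n. n \<in> V \<Longrightarrow> infnorm (a n - q) \<le> R"
  shows "real (card V) \<le> real N * (2 * R / s + 2) ^ CARD('n)"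
proof -
  define fib where "fib b = {n \<in> V. grid_cell s (a n - q) = b}" for b
  have fib_card: "card (fib b) \<le> N" for b
  proof (cases "fib b = {}")
    case False
    have fin: "finite (fib b)"
      using \<open>finite V\<close> by (simp add: fib_def)
    define m where "m = Min (fib b)"
    have m: "m \<in> fib b"
      using fin False by (simp add: m_def)
    have "n < m + N" if n: "n \<in> fib b" for n
    proof (rule ccontr)
      assume "\<not> n < m + N"
      then have "infnorm (a n - a m) > s"
        using sep m n by (simp add: fib_def)
      moreover have "infnorm ((a n - q) - (a m - q)) \<le> s"
        using m n by (intro infnorm_diff_le_same_cell \<open>s > 0\<close>) (simp add: fib_def)
      ultimately show False
        by simp
    qed
    \<comment> \<open>All times in the cell lie in a window of length \<open>N\<close> that starts
      at the earliest one.\<close>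
    then have "fib b \<subseteq> {m..<m + N}"
      using fin by (auto simp: m_def)
    then show ?thesis
      using card_mono[of "{m..<m + N}" "fib b"] by simp
  qed simp
  have "V = (\<Union>b\<in>grid_box s R. fib b)"
    using grid_cell_in_box[OF \<open>s > 0\<close> near] by (auto simp: fib_def)
  then have "card V \<le> (\<Sum>b\<in>(grid_box s R :: ('n \<Rightarrow> int) set). card (fib b))"
    using card_UN_le[of "grid_box s R :: ('n \<Rightarrow> int) set" fib] by simp
  also have "\<dots> \<le> card (grid_box s R :: ('n \<Rightarrow> int) set) * N"
    using sum_bounded_above[of "grid_box s R" "\<lambda>b. card (fib b)" N] fib_card by simp
  finally have "real (card V) \<le> real (card (grid_box s R :: ('n \<Rightarrow> int) set)) * real N"
    by (metis of_nat_le_iff of_nat_mult)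
  also have "\<dots> \<le> (2 * R / s + 2) ^ CARD('n) * real N"
    by (intro mult_right_mono card_grid_box_le assms) simp
  finally show ?thesis
    by (simp add: mult.commute)
qed

text \<open>The two coordinates are independent copies, so both values fall into one given cell with
  the square of the cell probability. By Cauchy-Schwarz the sum of these squares is at least the
  square of the total mass divided by the number of cells.\<close>

lemma prob_independent_difference_ge:
  fixes g :: "'a \<Rightarrow> real ^ 'n::finite"
  assumes "prob_space M" and [measurable]: "g \<in> borel_measurable M"
    and "r > 0" "Q \<ge> 0" "e \<ge> 0"
    and e: "measure M {x \<in> space M. infnorm (g x) \<le> Q} \<ge> e"
  shows "measure (M \<Otimes>\<^sub>M M) {z \<in> space (M \<Otimes>\<^sub>M M). infnorm (g (fst z) - g (snd z)) \<le> r}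
      \<ge> e\<^sup>2 / (2 * Q / r + 2) ^ CARD('n)"
proof -
  interpret prob_space M by fact
  interpret P: pair_prob_space M M ..
  define B where "B = (grid_box r Q :: ('n \<Rightarrow> int) set)"
  define A where "A b = {x \<in> space M. infnorm (g x) \<le> Q \<and> grid_cell r (g x) = b}" for b
  have [measurable]: "A b \<in> sets M" for b
    unfolding A_def by measurable
  have fin: "finite B"
    by (simp add: B_def)
  have disj: "disjoint_family_on A B" "disjoint_family_on (\<lambda>b. A b \<times> A b) B"
    by (auto simp: disjoint_family_on_def A_def)
  have "{x \<in> space M. infnorm (g x) \<le> Q} = (\<Union>b\<in>B. A b)"
    using grid_cell_in_box[OF \<open>r > 0\<close>] by (auto simp: A_def B_def)
  then have "e \<le> (\<Sum>b\<in>B. prob (A b))"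
    using e fin disj by (simp add: finite_measure_finite_Union image_subset_iff)
  then have "e\<^sup>2 \<le> (\<Sum>b\<in>B. prob (A b))\<^sup>2"
    using \<open>e \<ge> 0\<close> by (rule power_mono)
  also have "\<dots> \<le> (\<Sum>b\<in>B. (prob (A b))\<^sup>2) * real (card B)"
    by (rule sum_squared_le_sum_of_squares)
  also have "(\<Sum>b\<in>B. (prob (A b))\<^sup>2) = (\<Sum>b\<in>B. P.prob (A b \<times> A b))"
    by (simp add: measure_def emeasure_pair_measure_Times enn2real_mult power2_eq_square)
  also have "\<dots> = P.prob (\<Union>b\<in>B. A b \<times> A b)"
    using fin disj by (subst P.finite_measure_finite_Union) (auto simp: image_subset_iff)
  also have "\<dots> \<le> P.prob {z \<in> space (M \<Otimes>\<^sub>M M). infnorm (g (fst z) - g (snd z)) \<le> r}"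
    by (intro P.finite_measure_mono)
      (auto simp: A_def space_pair_measure intro!: infnorm_diff_le_same_cell \<open>r > 0\<close>)
  finally have "e\<^sup>2 \<le> P.prob {z \<in> space (M \<Otimes>\<^sub>M M). infnorm (g (fst z) - g (snd z)) \<le> r}
      * real (card B)"
    by (simp add: mult_right_mono)
  also have "\<dots> \<le> P.prob {z \<in> space (M \<Otimes>\<^sub>M M). infnorm (g (fst z) - g (snd z)) \<le> r}
      * (2 * Q / r + 2) ^ CARD('n)"
    unfolding B_def by (intro mult_left_mono card_grid_box_le assms) simp
  finally show ?thesis
    using \<open>r > 0\<close> \<open>Q \<ge> 0\<close>
    by (subst pos_divide_le_eq) (auto intro!: zero_less_power add_nonneg_pos)
qed

subsection \<open>Ergodicity of the pair of coordinate maps\<close>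

lemma measure_preserving_measurable:
  "measure_preserving M T \<Longrightarrow> T \<in> M \<rightarrow>\<^sub>M M"
  by (simp add: measure_preserving_def)

lemma measure_preserving_AE:
  assumes "measure_preserving M T" "AE x in M. P x"
  shows "AE x in M. P (T x)"
  using assms by (metis AE_distrD measure_preserving_def)

lemma measure_preserving_measure:
  assumes "measure_preserving M T" "A \<in> sets M"
  shows "measure M {x \<in> space M. T x \<in> A} = measure M A"
proof -
  have "measure M A = measure (distr M M T) A"
    using assms by (simp add: measure_preserving_def)
  also have "\<dots> = measure M (T -` A \<inter> space M)"
    using assms by (intro measure_distr) (auto simp: measure_preserving_def)
  also have "T -` A \<inter> space M = {x \<in> space M. T x \<in> A}"
    by auto
  finally show ?thesis ..
qed

lemma measure_preserving_integral:
  fixes u :: "'a \<Rightarrow> real"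
  assumes "measure_preserving M T" "u \<in> borel_measurable M"
  shows "(\<integral>x. u (T x) \<partial>M) = (\<integral>x. u x \<partial>M)"
proof -
  have "(\<integral>x. u x \<partial>M) = (\<integral>x. u x \<partial>distr M M T)"
    using assms by (simp add: measure_preserving_def)
  also have "\<dots> = (\<integral>x. u (T x) \<partial>M)"
    using assms by (intro integral_distr) (auto simp: measure_preserving_def)
  finally show ?thesis ..
qed

lemma measure_preserving_pair:
  assumes "prob_space M" "measure_preserving M S" "measure_preserving M T"
  shows "measure_preserving (M \<Otimes>\<^sub>M M) (\<lambda>(x, y). (S x, T y))"
proof -
  interpret prob_space M by fact
  have [measurable]: "S \<in> M \<rightarrow>\<^sub>M M" "T \<in> M \<rightarrow>\<^sub>M M"
    using assms by (auto simp: measure_preserving_def)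
  have "sigma_finite_measure (distr M M T)"
    using assms(3) by (simp add: measure_preserving_def sigma_finite_measure_axioms)
  then have "distr M M S \<Otimes>\<^sub>M distr M M T = distr (M \<Otimes>\<^sub>M M) (M \<Otimes>\<^sub>M M) (\<lambda>(x, y). (S x, T y))"
    by (intro pair_measure_distr) auto
  then show ?thesis
    using assms by (simp add: measure_preserving_def)
qed

lemma measure_preserving_id: "measure_preserving M (\<lambda>x. x)"
  by (simp add: measure_preserving_def distr_id[unfolded id_def])

lemma measure_preserving_funpow:
  assumes "measure_preserving M T"
  shows "measure_preserving M (T ^^ n)"
proof (induction n)
  case (Suc n)
  have "distr M M (T \<circ> T ^^ n) = distr (distr M M (T ^^ n)) M T"
    using Suc assms by (subst distr_distr) (auto simp: measure_preserving_def)
  then show ?case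
    using Suc assms by (auto simp: measure_preserving_def comp_def)
qed (simp add: measure_preserving_def id_def distr_id[unfolded id_def])

text \<open>The set of points visiting \<open>A\<close> infinitely often is a strictly invariant version of \<open>A\<close>.\<close>
lemma ergodic_AE_invariant:
  assumes "prob_space M" "measure_preserving M T" "ergodic M T"
    and [measurable]: "A \<in> sets M"
    and inv: "AE x in M. T x \<in> A \<longleftrightarrow> x \<in> A"
  shows "measure M A = 0 \<or> measure M A = 1"
proof -
  interpret prob_space M by fact
  have [measurable]: "T \<in> M \<rightarrow>\<^sub>M M"
    using assms(2) by (rule measure_preserving_measurable)
  have [measurable]: "(T ^^ n) \<in> M \<rightarrow>\<^sub>M M" for n
    using assms(2) by (intro measure_preserving_measurable measure_preserving_funpow)
  define B where "B = {x \<in> space M. \<forall>n. \<exists>k\<ge>n. (T ^^ k) x \<in> A}"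
  have [measurable]: "B \<in> sets M"
    unfolding B_def by measurable
  have "(\<forall>n. \<exists>k\<ge>n. (T ^^ k) (T x) \<in> A) \<longleftrightarrow> (\<forall>n. \<exists>k\<ge>n. (T ^^ k) x \<in> A)" for x
  proof -
    have shift: "(T ^^ k) (T x) = (T ^^ Suc k) x" for k
      by (simp only: funpow_Suc_right comp_apply)
    have "(\<exists>k\<ge>n. (T ^^ k) (T x) \<in> A) \<longleftrightarrow> (\<exists>k\<ge>Suc n. (T ^^ k) x \<in> A)" for n
      unfolding shift by (metis Suc_le_D Suc_le_mono)
    then show ?thesis
      by (metis Suc_leD)
  qed
  then have "T -` B \<inter> space M = B"
    using measurable_space[OF \<open>T \<in> M \<rightarrow>\<^sub>M M\<close>] by (auto simp: B_def)
  then have "emeasure M B = 0 \<or> emeasure M B = 1"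
    using \<open>ergodic M T\<close> \<open>B \<in> sets M\<close> by (simp add: ergodic_def)
  then have B: "prob B = 0 \<or> prob B = 1"
    by (auto simp: measure_def)
  have "AE x in M. (T ^^ n) x \<in> A \<longleftrightarrow> x \<in> A" for n
  proof (induction n)
    case (Suc n)
    show ?case
      using measure_preserving_AE[OF assms(2) Suc] inv
      by eventually_elim (simp only: funpow_Suc_right comp_apply)
  qed simp
  then have "AE x in M. \<forall>n. (T ^^ n) x \<in> A \<longleftrightarrow> x \<in> A"
    by (simp add: AE_all_countable)
  then have "AE x in M. x \<in> B \<longleftrightarrow> x \<in> A"
    by (rule AE_mp) (auto simp: B_def)
  then have "prob B = prob A"
    by (intro finite_measure_eq_AE) auto
  then show ?thesis
    using B by simp
qed

lemma ergodic_pair_AE_invariant: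
  assumes "prob_space M" "measure_preserving M T" "ergodic M T"
    and A [measurable]: "A \<in> sets (M \<Otimes>\<^sub>M M)"
    and inv1: "AE z in M \<Otimes>\<^sub>M M. (T (fst z), snd z) \<in> A \<longleftrightarrow> z \<in> A"
    and inv2: "AE z in M \<Otimes>\<^sub>M M. (fst z, T (snd z)) \<in> A \<longleftrightarrow> z \<in> A"
  shows "measure (M \<Otimes>\<^sub>M M) A = 0 \<or> measure (M \<Otimes>\<^sub>M M) A = 1"
proof -
  interpret prob_space M by fact
  interpret P: pair_prob_space M M ..
  have T [measurable]: "T \<in> M \<rightarrow>\<^sub>M M"
    using assms(2) by (rule measure_preserving_measurable)
  define m where "m x = emeasure M (Pair x -` A)" for x
  have [measurable]: "m \<in> borel_measurable M"
    unfolding m_def by (rule measurable_emeasure_Pair) (fact A)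
  have sec [measurable]: "Pair x -` A \<in> sets M" for x
    using A by (rule sets_Pair1)
  define E where "E = {x \<in> space M. m x = 1}"
  have [measurable]: "E \<in> sets M"
    unfolding E_def by measurable
  have "AE x in M. AE y in M. (x, T y) \<in> A \<longleftrightarrow> (x, y) \<in> A"
    using P.AE_pair[OF inv2] by simp
  then have m01: "AE x in M. m x = 0 \<or> m x = 1"
  proof eventually_elim
    case (elim x)
    then have "prob (Pair x -` A) = 0 \<or> prob (Pair x -` A) = 1"
      by (intro ergodic_AE_invariant[OF assms(1-3)]) auto
    then show ?case
      by (auto simp: m_def emeasure_eq_measure)
  qed
  have "AE x in M. AE y in M. (T x, y) \<in> A \<longleftrightarrow> (x, y) \<in> A"
    using P.AE_pair[OF inv1] by simp
  then have "AE x in M. m (T x) = m x"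
  proof eventually_elim
    case (elim x)
    then show ?case
      unfolding m_def by (intro emeasure_eq_AE) auto
  qed
  then have "AE x in M. T x \<in> E \<longleftrightarrow> x \<in> E"
    using measurable_space[OF T] by (auto simp: E_def)
  then have "prob E = 0 \<or> prob E = 1"
    by (intro ergodic_AE_invariant[OF assms(1-3)]) auto
  moreover have "emeasure (M \<Otimes>\<^sub>M M) A = (\<integral>\<^sup>+x. m x \<partial>M)"
    unfolding m_def by (rule emeasure_pair_measure_alt) (fact A)
  \<comment> \<open>Up to a null set the section measure is the indicator of \<open>E\<close>, so
    \<open>A\<close> has the same measure as \<open>E\<close>.\<close>
  moreover have "(\<integral>\<^sup>+x. m x \<partial>M) = (\<integral>\<^sup>+x. indicator E x \<partial>M)"
    using m01 by (intro nn_integral_cong_AE) (auto simp: E_def indicator_def)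
  ultimately show ?thesis
    by (auto simp: measure_def)
qed

subsection \<open>Averages along the coordinate maps\<close>

text \<open>These are convex combinations of \<open>w\<close> composed with words in
  \<open>G\<close>. Midpoints suffice for the parallelogram law, and the inductive form allows visit
  bounds to be propagated from \<open>w\<close> one operation at a time.\<close>

inductive_set averages :: "('z \<Rightarrow> 'z) set \<Rightarrow> ('z \<Rightarrow> real) \<Rightarrow> ('z \<Rightarrow> real) set"
  for G :: "('z \<Rightarrow> 'z) set" and w :: "'z \<Rightarrow> real" where
  base: "w \<in> averages G w"
| shift: "u \<in> averages G w \<Longrightarrow> g \<in> G \<Longrightarrow> (\<lambda>z. u (g z)) \<in> averages G w"
| midpoint: "u \<in> averages G w \<Longrightarrow> v \<in> averages G w \<Longrightarrow> (\<lambda>z. (u z + v z) / 2) \<in> averages G w"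

lemma averages_measurable:
  assumes "u \<in> averages G w" "w \<in> borel_measurable M" "\<And>g. g \<in> G \<Longrightarrow> g \<in> M \<rightarrow>\<^sub>M M"
  shows "u \<in> borel_measurable M"
  using assms(1)
proof induction
  case (shift u g)
  then show ?case
    using assms(3)[of g] by measurable
next
  case (midpoint u v)
  then show ?case
    by measurable
qed (fact assms)

lemma averages_bounds:
  assumes "u \<in> averages G w" "\<And>z. 0 \<le> w z \<and> w z \<le> 1"
  shows "0 \<le> u z \<and> u z \<le> 1"
  using assms(1)
proof (induction arbitrary: z)
  case (midpoint u v)
  then have "0 \<le> u z" "u z \<le> 1" "0 \<le> v z" "v z \<le> 1"
    by blast+
  then show ?case
    by simp
qed (use assms in auto)

lemma averages_integral:
  assumes "prob_space M" "u \<in> averages G w" "w \<in> borel_measurable M"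
    and w01: "\<And>z. 0 \<le> w z \<and> w z \<le> 1"
    and G: "\<And>g. g \<in> G \<Longrightarrow> measure_preserving M g"
  shows "(\<integral>z. u z \<partial>M) = (\<integral>z. w z \<partial>M)"
proof -
  interpret prob_space M by fact
  have meas: "u \<in> borel_measurable M" if "u \<in> averages G w" for u
    using that assms(3) G by (blast intro: averages_measurable measure_preserving_measurable)
  have int: "integrable M u" if "u \<in> averages G w" for u
    using meas[OF that] averages_bounds[OF that w01]
    by (intro integrable_const_bound[where B = 1]) auto
  show ?thesis
    using assms(2)
  proof induction
    case (shift u g)
    then show ?case
      using measure_preserving_integral[OF G meas] by simp
  next
    case (midpoint u v)
    then show ?case
      using int by simp
  qed simp
qed

text \<open>This is nonnegativity of the variance of \<open>\<bar>v\<bar>\<close>. It turns second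
  moment bounds into bounds on first absolute moments.\<close>

lemma (in prob_space) expectation_abs_sq_le:
  assumes [measurable]: "v \<in> borel_measurable M" and "\<And>z. \<bar>v z\<bar> \<le> (1::real)"
  shows "(expectation (\<lambda>z. \<bar>v z\<bar>))\<^sup>2 \<le> expectation (\<lambda>z. (v z)\<^sup>2)"
proof -
  have i1: "integrable M (\<lambda>z. \<bar>v z\<bar>)"
    using assms by (intro integrable_const_bound[where B = 1]) auto
  have i2: "integrable M (\<lambda>z. \<bar>v z\<bar>\<^sup>2)"
    using assms by (intro integrable_const_bound[where B = 1]) (auto simp: abs_square_le_1)
  have "0 \<le> variance (\<lambda>z. \<bar>v z\<bar>)"
    by (rule variance_positive)
  then show ?thesis
    using variance_eq[OF i1 i2] by simp
qed

text \<open>By Tonelli the pointwise sum has finite expectation. This yields almost everywhere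
  convergence directly, without passing to subsequences.\<close>

lemma (in prob_space) AE_summable_of_summable_expectation:
  fixes v :: "nat \<Rightarrow> 'a \<Rightarrow> real"
  assumes [measurable]: "\<And>k. v k \<in> borel_measurable M"
    and bound: "\<And>k z. \<bar>v k z\<bar> \<le> 1"
    and exp: "\<And>k. expectation (\<lambda>z. \<bar>v k z\<bar>) \<le> b k" and "summable b"
  shows "AE z in M. summable (\<lambda>k. \<bar>v k z\<bar>)"
proof -
  have int: "integrable M (\<lambda>z. \<bar>v k z\<bar>)" for k
    using bound by (intro integrable_const_bound[where B = 1]) auto
  have b: "0 \<le> b k" for k
    using exp[of k] by (meson Bochner_Integration.integral_nonneg abs_ge_zero order_trans)
  have "(\<integral>\<^sup>+z. (\<Sum>k. ennreal \<bar>v k z\<bar>) \<partial>M) = (\<Sum>k. \<integral>\<^sup>+z. ennreal \<bar>v k z\<bar> \<partial>M)"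
    by (rule nn_integral_suminf) measurable
  also have "\<dots> = (\<Sum>k. ennreal (expectation (\<lambda>z. \<bar>v k z\<bar>)))"
    using int by (simp add: nn_integral_eq_integral)
  also have "\<dots> \<le> (\<Sum>k. ennreal (b k))"
    using exp by (intro suminf_le ennreal_leI) auto
  also have "\<dots> < \<infinity>"
    using \<open>summable b\<close> b by (simp add: suminf_ennreal2)
  finally have "AE z in M. (\<Sum>k. ennreal \<bar>v k z\<bar>) \<noteq> \<infinity>"
    by (intro nn_integral_PInf_AE) auto
  then show ?thesis
  proof (rule AE_mp, intro AE_I2 impI)
    fix z
    assume "(\<Sum>k. ennreal \<bar>v k z\<bar>) \<noteq> \<infinity>"
    then show "summable (\<lambda>k. \<bar>v k z\<bar>)"
      using summable_suminf_not_top[of "\<lambda>k. \<bar>v k z\<bar>"] by simp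
  qed
qed

text \<open>Von Neumann's mean ergodic theorem by convexity: a sequence of averages of \<open>w\<close> that
  minimises the second moment is Cauchy by the parallelogram law and asymptotically invariant,
  so its limit is the constant \<open>\<integral>w\<close>.\<close>
lemma (in prob_space) averages_concentrate:
  fixes w :: "'a \<Rightarrow> real"
  assumes w: "w \<in> borel_measurable M" and w01: "\<And>z. 0 \<le> w z \<and> w z \<le> 1"
    and G: "\<And>g. g \<in> G \<Longrightarrow> measure_preserving M g"
    and erg: "\<And>A. A \<in> sets M \<Longrightarrow> (\<And>g. g \<in> G \<Longrightarrow> AE z in M. g z \<in> A \<longleftrightarrow> z \<in> A)
      \<Longrightarrow> prob A = 0 \<or> prob A = 1"
    and h: "h < expectation w" and "c > 0"
  shows "\<exists>u\<in>averages G w. prob {z \<in> space M. u z < h} < c"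
proof -
  let ?A = "averages G w"
  have meas: "u \<in> borel_measurable M" if "u \<in> ?A" for u
    using that w G by (blast intro: averages_measurable measure_preserving_measurable)
  have bounds: "0 \<le> u z" "u z \<le> 1" if "u \<in> ?A" for u z
    using averages_bounds[OF that w01] by auto
  have sq1: "(u z)\<^sup>2 \<le> 1" if "u \<in> ?A" for u z
    using bounds[OF that, of z] by (simp add: abs_square_le_1)
  have int: "integrable M u" if "u \<in> ?A" for u
    using meas[OF that] bounds[OF that]
    by (intro integrable_const_bound[where B = 1]) auto
  have int2: "integrable M (\<lambda>z. (u z)\<^sup>2)" if "u \<in> ?A" for u
    using meas[OF that] sq1[OF that]
    by (intro integrable_const_bound[where B = 1]) auto
  define e where "e u = expectation (\<lambda>z. (u z)\<^sup>2)" for u :: "'a \<Rightarrow> real"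
  define m where "m = (INF u\<in>?A. e u)"
  have bdd: "bdd_below (e ` ?A)"
    by (auto simp: e_def intro!: bdd_belowI[where m = 0])
  have m_le: "m \<le> e u" if "u \<in> ?A" for u
    unfolding m_def using bdd that by (rule cINF_lower)
  \<comment> \<open>The midpoint is again an average, so its second moment is at least
    \<open>m\<close>; this bounds the distance of two near-minimisers by their excess over
    \<open>m\<close>.\<close>
  have parallelogram: "expectation (\<lambda>z. (u z - v z)\<^sup>2) \<le> 2 * (e u - m) + 2 * (e v - m)"
    if u: "u \<in> ?A" and v: "v \<in> ?A" for u v
  proof -
    let ?p = "\<lambda>z. (u z + v z) / 2"
    have p: "?p \<in> ?A"
      using u v by (rule averages.midpoint)
    have "(u z - v z)\<^sup>2 = 2 * (u z)\<^sup>2 + 2 * (v z)\<^sup>2 - 4 * (?p z)\<^sup>2" for z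
      by (simp add: power2_eq_square field_simps)
    then have "expectation (\<lambda>z. (u z - v z)\<^sup>2) =
        expectation (\<lambda>z. 2 * (u z)\<^sup>2 + 2 * (v z)\<^sup>2 - 4 * (?p z)\<^sup>2)"
      by simp
    also have "\<dots> = 2 * e u + 2 * e v - 4 * e ?p"
      using int2[OF u] int2[OF v] int2[OF p] by (simp add: e_def del: power_divide)
    finally show ?thesis
      using m_le[OF p] by simp
  qed
  \<comment> \<open>The excess \<open>(1 / 4) ^ k\<close> has square root
    \<open>(1 / 2) ^ k\<close>, which is still summable.\<close>
  have "\<exists>u\<in>?A. e u < m + (1 / 4) ^ k" for k :: nat
  proof -
    have "(INF u\<in>?A. e u) < m + (1 / 4) ^ k"
      by (simp add: m_def)
    then show ?thesis
      using bdd averages.base[of w G] by (subst (asm) cINF_less_iff) auto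
  qed
  then obtain U where U: "\<And>k. U k \<in> ?A" and eU: "\<And>k. e (U k) < m + (1 / 4) ^ k"
    by metis
  have UM [measurable]: "U k \<in> borel_measurable M" for k
    using U by (rule meas)
  have near: "expectation (\<lambda>z. \<bar>U k z - v z\<bar>) \<le> 2 * (1 / 2) ^ k"
    if v: "v \<in> ?A" "e v < m + (1 / 4) ^ k" for k v
  proof -
    have [measurable]: "v \<in> borel_measurable M"
      using v(1) by (rule meas)
    have "\<bar>U k z - v z\<bar> \<le> 1" for z
      using bounds[OF U, of k z] bounds[OF v(1), of z] by linarith
    then have "(expectation (\<lambda>z. \<bar>U k z - v z\<bar>))\<^sup>2 \<le> expectation (\<lambda>z. (U k z - v z)\<^sup>2)"
      by (intro expectation_abs_sq_le) auto
    also have "\<dots> \<le> 2 * (e (U k) - m) + 2 * (e v - m)"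
      by (rule parallelogram[OF U v(1)])
    also have "\<dots> \<le> 4 * (1 / 4) ^ k"
      using eU[of k] v(2) by simp
    also have "(1 / 4 :: real) ^ k = ((1 / 2)\<^sup>2) ^ k"
      by (simp add: power_one_over)
    also have "4 * ((1 / 2 :: real)\<^sup>2) ^ k = (2 * (1 / 2) ^ k)\<^sup>2"
      by (simp only: power_mult_distrib power_mult[symmetric] mult.commute) simp
    finally show ?thesis
      by (rule power2_le_imp_le) simp
  qed
  \<comment> \<open>The bound \<open>near\<close> holds for any competing near-minimiser. It is used
    with \<open>U (Suc k)\<close> to get convergence and with \<open>U k\<close> composed with
    \<open>g\<close> to get invariance of the limit.\<close>
  have sum2: "summable (\<lambda>k. 2 * (1 / 2) ^ k :: real)"
    by (intro summable_mult summable_geometric) simp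
  have AE_summable: "AE z in M. summable (\<lambda>k. \<bar>U k z - V k z\<bar>)"
    if V: "\<And>k. V k \<in> ?A" "\<And>k. e (V k) < m + (1 / 4) ^ k" for V
  proof (rule AE_summable_of_summable_expectation)
    have [measurable]: "V k \<in> borel_measurable M" for k
      using V(1) by (rule meas)
    show "(\<lambda>z. U k z - V k z) \<in> borel_measurable M" for k
      by measurable
    show "\<bar>U k z - V k z\<bar> \<le> 1" for k z
      using bounds[OF U, of k z] bounds[OF V(1), of k z] by linarith
    show "expectation (\<lambda>z. \<bar>U k z - V k z\<bar>) \<le> 2 * (1 / 2) ^ k" for k
      by (rule near[OF V])
  qed (rule sum2)
  define L where "L z = lim (\<lambda>k. U k z)" for z
  have [measurable]: "L \<in> borel_measurable M"
    unfolding L_def by measurable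
  have "AE z in M. summable (\<lambda>k. \<bar>U k z - U (Suc k) z\<bar>)"
  proof (rule AE_summable[OF U])
    show "e (U (Suc k)) < m + (1 / 4) ^ k" for k
      using eU[of "Suc k"] power_decreasing[of k "Suc k" "1 / 4 :: real"] by linarith
  qed
  then have lim: "AE z in M. (\<lambda>k. U k z) \<longlonglongrightarrow> L z"
  proof eventually_elim
    case (elim z)
    then have "summable (\<lambda>k. U k z - U (Suc k) z)"
      by (rule summable_rabs_cancel)
    then have "convergent (\<lambda>n. \<Sum>k<n. U k z - U (Suc k) z)"
      by (simp add: summable_iff_convergent)
    then have "convergent (\<lambda>n. U 0 z - U n z)"
      by (simp add: sum_lessThan_telescope'[of "\<lambda>k. U k z"])
    then have "convergent (\<lambda>n. U 0 z - (U 0 z - U n z))"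
      by (rule convergent_diff[OF convergent_const])
    then show ?case
      by (simp add: L_def convergent_LIMSEQ_iff)
  qed
  have L_inv: "AE z in M. L (g z) = L z" if g: "g \<in> G" for g
  proof -
    \<comment> \<open>Composition with \<open>g\<close> keeps the second moment, so it maps
      near-minimisers to near-minimisers of the same quality.\<close>
    have "e (\<lambda>z. U k (g z)) = e (U k)" for k
      unfolding e_def using measure_preserving_integral[OF G[OF g], of "\<lambda>z. (U k z)\<^sup>2"] by simp
    then have "e (\<lambda>z. U k (g z)) < m + (1 / 4) ^ k" for k
      using eU by simp
    then have 1: "AE z in M. summable (\<lambda>k. \<bar>U k z - U k (g z)\<bar>)"
      by (rule AE_summable[OF averages.shift[OF U g]])
    have 2: "AE z in M. (\<lambda>k. U k (g z)) \<longlonglongrightarrow> L (g z)"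
      by (rule measure_preserving_AE[OF G[OF g] lim])
    have 3: "L (g z) = L z" if s: "summable (\<lambda>k. \<bar>U k z - U k (g z)\<bar>)"
      and Lg: "(\<lambda>k. U k (g z)) \<longlonglongrightarrow> L (g z)" and Lz: "(\<lambda>k. U k z) \<longlonglongrightarrow> L z" for z
    proof -
      have "(\<lambda>k. U k z - U k (g z)) \<longlonglongrightarrow> 0"
        by (rule summable_LIMSEQ_zero[OF summable_rabs_cancel[OF s]])
      then have "L z - L (g z) = 0"
        by (rule LIMSEQ_unique[OF tendsto_diff[OF Lz Lg]])
      then show ?thesis
        by simp
    qed
    show ?thesis
      by (rule AE_mp[OF 1 AE_mp[OF 2 AE_mp[OF lim]]]) (intro AE_I2 impI 3)
  qed
  have L_mean: "expectation L = expectation w" and L_int: "integrable M L"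
  proof -
    have "AE z in M. norm (U k z) \<le> 1" for k
      using bounds[OF U] by simp
    note dom = integrable_dominated_convergence[of L M U "\<lambda>_. 1", OF _ _ _ lim this]
      integral_dominated_convergence[of L M U "\<lambda>_. 1", OF _ _ _ lim this]
    show "integrable M L"
      using dom(1) by simp
    have "(\<lambda>k. expectation (U k)) \<longlonglongrightarrow> expectation L"
      using dom(2) by simp
    moreover have "expectation (U k) = expectation w" for k
      using averages_integral[OF prob_space_axioms U w w01 G] by simp
    ultimately show "expectation L = expectation w"
      by (simp add: LIMSEQ_const_iff)
  qed
  \<comment> \<open>The gap between \<open>h\<close> and \<open>h'\<close> is needed below: from
    \<open>L z \<ge> h'\<close> follows \<open>L z > h\<close>, hence \<open>U k z > h\<close> for
    all large \<open>k\<close>.\<close>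
  obtain h' where h': "h < h'" "h' < expectation w"
    using h dense by blast
  define B where "B = {z \<in> space M. L z < h'}"
  have [measurable]: "B \<in> sets M"
    unfolding B_def by measurable
  have "AE z in M. g z \<in> B \<longleftrightarrow> z \<in> B" if g: "g \<in> G" for g
    using L_inv[OF g] AE_space
    by eventually_elim
      (use measurable_space[OF measure_preserving_measurable[OF G[OF g]]] in \<open>auto simp: B_def\<close>)
  then have "prob B = 0 \<or> prob B = 1"
    by (intro erg) auto
  \<comment> \<open>Otherwise the mean of \<open>L\<close>, which equals that of \<open>w\<close>,
    would be at most \<open>h'\<close>.\<close>
  moreover have "prob B \<noteq> 1"
  proof
    assume "prob B = 1"
    then have "AE z in M. L z \<le> h'"
      by (rule AE_mp[OF AE_prob_1]) (auto simp: B_def)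
    then have "expectation L \<le> expectation (\<lambda>_. h')"
      by (intro integral_mono_AE L_int) auto
    then show False
      using h' L_mean by (simp add: prob_space)
  qed
  ultimately have "AE z in M. z \<notin> B"
    using prob_eq_0[OF \<open>B \<in> sets M\<close>] by simp
  then have "AE z in M. (\<lambda>k. indicat_real {z. U k z < h} z) \<longlonglongrightarrow> 0"
    using lim AE_space
  proof eventually_elim
    case (elim z)
    then have "h < L z"
      using h' by (auto simp: B_def)
    then have "eventually (\<lambda>k. U k z > h) sequentially"
      using elim(2) by (simp add: order_tendstoD)
    then have "eventually (\<lambda>k. indicat_real {z. U k z < h} z = 0) sequentially"
      by eventually_elim simp
    then show ?case
      by (rule tendsto_eventually)
  qed
  then have "(\<lambda>k. expectation (indicat_real {z. U k z < h})) \<longlonglongrightarrow> expectation (\<lambda>_. 0)"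
    by (intro integral_dominated_convergence[where w = "\<lambda>_. 1"]) (auto simp: indicator_def)
  moreover have "expectation (indicat_real {z. U k z < h}) = prob {z \<in> space M. U k z < h}" for k
  proof -
    have "expectation (indicat_real {z. U k z < h})
        = expectation (indicat_real {z \<in> space M. U k z < h})"
      by (intro Bochner_Integration.integral_cong) (auto simp: indicator_def)
    then show ?thesis
      by simp
  qed
  ultimately have "(\<lambda>k. prob {z \<in> space M. U k z < h}) \<longlonglongrightarrow> 0"
    by simp
  then have "eventually (\<lambda>k. prob {z \<in> space M. U k z < h} < c) sequentially"
    using \<open>c > 0\<close> by (simp add: order_tendstoD)
  then obtain k where "prob {z \<in> space M. U k z < h} < c"
    using eventually_happens'[OF sequentially_bot] by blast
  then show ?thesis
    using U by blast
qed

subsection \<open>Counting visits\<close>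

text \<open>The sets where the norm exceeds \<open>k\<close> decrease to the empty set. The lemma
  bounds transfer functions off a set of small measure.\<close>

lemma (in prob_space) infnorm_tight:
  fixes p :: "'a \<Rightarrow> 'b::euclidean_space"
  assumes [measurable]: "p \<in> borel_measurable M" and "e > 0"
  shows "\<exists>R\<ge>0. prob {z \<in> space M. infnorm (p z) > R} < e"
proof -
  have "(\<lambda>k::nat. prob {z \<in> space M. infnorm (p z) > real k})
      \<longlonglongrightarrow> prob (\<Inter>k::nat. {z \<in> space M. infnorm (p z) > real k})"
    by (rule finite_Lim_measure_decseq) (auto simp: decseq_def)
  moreover have "(\<Inter>k::nat. {z \<in> space M. infnorm (p z) > real k}) = {}"
    by (auto, meson not_less real_arch_simple)
  ultimately have "eventually (\<lambda>k::nat. prob {z \<in> space M. infnorm (p z) > real k} < e) sequentially"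
    using \<open>e > 0\<close> by (simp add: order_tendstoD)
  then obtain k :: nat where "prob {z \<in> space M. infnorm (p z) > real k} < e"
    using eventually_happens'[OF sequentially_bot] by blast
  then show ?thesis
    by (intro exI[of _ "real k"]) simp
qed

text \<open>Induction on the construction of \<open>u\<close>. A shift by \<open>g\<close> changes
  \<open>F\<close> by a coboundary: its part at \<open>z\<close> moves the centre \<open>q\<close>,
  and its part at the visited point is bounded once a small set of such points is discarded, which
  only enlarges \<open>R\<close>. At midpoints the good sets are intersected and the larger
  \<open>R\<close> is taken. The factor \<open>c\<close> never changes.\<close>

lemma (in prob_space) averages_visits_le:
  fixes F :: "nat \<Rightarrow> 'a \<Rightarrow> real ^ 'n::finite"
  assumes w01: "\<And>z. 0 \<le> w z \<and> w z \<le> 1"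
    and G: "\<And>g. g \<in> G \<Longrightarrow> measure_preserving M g"
    and commute: "\<And>g n z. g \<in> G \<Longrightarrow> (S ^^ n) (g z) = g ((S ^^ n) z)"
    and cohom: "\<And>g. g \<in> G \<Longrightarrow>
      \<exists>p\<in>borel_measurable M. \<forall>n z. F n (g z) = F n z + p ((S ^^ n) z) - p z"
    and S: "\<And>n z. z \<in> space M \<Longrightarrow> (S ^^ n) z \<in> space M"
    and "c \<ge> 0" "s \<ge> 0"
    and visits: "\<And>z q r J. finite J \<Longrightarrow> z \<in> space M \<Longrightarrow> r \<ge> s \<Longrightarrow>
      (\<Sum>n\<in>J. of_bool (infnorm (F n z - q) \<le> r) * w ((S ^^ n) z)) \<le> c * r ^ d"
    and "u \<in> averages G w" "e > 0"
  shows "\<exists>D\<in>sets M. \<exists>R\<ge>0. prob (space M - D) < e \<and>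
    (\<forall>J z q r. finite J \<longrightarrow> z \<in> space M \<longrightarrow> r \<ge> s \<longrightarrow>
      (\<Sum>n\<in>J. of_bool ((S ^^ n) z \<in> D \<and> infnorm (F n z - q) \<le> r) * u ((S ^^ n) z))
        \<le> c * (r + R) ^ d)"
  using assms(9,10)
proof (induction arbitrary: e)
  case base
  show ?case
  proof (intro bexI[of _ "space M"] exI[of _ 0] conjI allI impI)
    fix J :: "nat set" and z q and r :: real
    assume "finite J" "z \<in> space M" "r \<ge> s"
    then show "(\<Sum>n\<in>J. of_bool ((S ^^ n) z \<in> space M \<and> infnorm (F n z - q) \<le> r) * w ((S ^^ n) z))
        \<le> c * (r + 0) ^ d"
      using visits[of J z r q] S by simp
  qed (use base in auto)
next
  case (shift u g)
  have [measurable]: "g \<in> M \<rightarrow>\<^sub>M M"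
    using G shift.hyps by (auto simp: measure_preserving_def)
  obtain p where [measurable]: "p \<in> borel_measurable M"
    and p: "\<And>n z. F n (g z) = F n z + p ((S ^^ n) z) - p z"
    using cohom[OF shift.hyps(2)] by blast
  obtain D R where D [measurable]: "D \<in> sets M" and R: "R \<ge> 0" "prob (space M - D) < e / 2"
    and DR: "\<And>J z q r. finite J \<Longrightarrow> z \<in> space M \<Longrightarrow> r \<ge> s \<Longrightarrow>
      (\<Sum>n\<in>J. of_bool ((S ^^ n) z \<in> D \<and> infnorm (F n z - q) \<le> r) * u ((S ^^ n) z))
        \<le> c * (r + R) ^ d"
    using shift.IH[of "e / 2"] shift.prems by auto
  obtain R' where R': "R' \<ge> 0" "prob {z \<in> space M. infnorm (p z) > R'} < e / 2"
    using infnorm_tight[of "p" "e / 2"] shift.prems by auto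
  \<comment> \<open>Half of the allowance \<open>e\<close> goes to the earlier exceptional set,
    pulled back by \<open>g\<close>, and half to the points where the transfer function is
    large.\<close>
  define D' where "D' = {z \<in> space M. g z \<in> D \<and> infnorm (p z) \<le> R'}"
  have D' [measurable]: "D' \<in> sets M"
    unfolding D'_def by measurable
  have "prob (space M - D')
      \<le> prob ({z \<in> space M. g z \<in> space M - D} \<union> {z \<in> space M. infnorm (p z) > R'})"
    using measurable_space[OF \<open>g \<in> M \<rightarrow>\<^sub>M M\<close>]
    by (intro finite_measure_mono) (auto simp: D'_def)
  also have "\<dots> \<le> prob {z \<in> space M. g z \<in> space M - D} + prob {z \<in> space M. infnorm (p z) > R'}"
    by (intro measure_Un_le) auto
  also have "prob {z \<in> space M. g z \<in> space M - D} = prob (space M - D)"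
    using G shift.hyps by (intro measure_preserving_measure) auto
  finally have "prob (space M - D') < e"
    using R R' by linarith
  moreover have "(\<Sum>n\<in>J. of_bool ((S ^^ n) z \<in> D' \<and> infnorm (F n z - q) \<le> r) * u (g ((S ^^ n) z)))
      \<le> c * (r + (R' + R)) ^ d" if J: "finite J" "z \<in> space M" "r \<ge> s" for J z q r
  proof -
    have gz: "g z \<in> space M"
      using measurable_space[OF \<open>g \<in> M \<rightarrow>\<^sub>M M\<close>] J by simp
    have u0: "0 \<le> u z" for z
      using averages_bounds[OF shift.hyps(1) w01] by blast
    have near: "infnorm (F n (g z) - (q - p z)) \<le> r + R'"
      if "(S ^^ n) z \<in> D'" "infnorm (F n z - q) \<le> r" for n
    proof -
      have "F n (g z) - (q - p z) = (F n z - q) + p ((S ^^ n) z)"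
        using p by simp
      then have "infnorm (F n (g z) - (q - p z)) = infnorm ((F n z - q) + p ((S ^^ n) z))"
        by (rule arg_cong)
      then show ?thesis
        using infnorm_triangle[of "F n z - q" "p ((S ^^ n) z)"] that unfolding D'_def by auto
    qed
    have "(\<Sum>n\<in>J. of_bool ((S ^^ n) z \<in> D' \<and> infnorm (F n z - q) \<le> r) * u (g ((S ^^ n) z)))
        \<le> (\<Sum>n\<in>J. of_bool ((S ^^ n) (g z) \<in> D \<and> infnorm (F n (g z) - (q - p z)) \<le> r + R')
            * u ((S ^^ n) (g z)))"
    proof (rule sum_mono)
      fix n
      have "(S ^^ n) z \<in> D' \<Longrightarrow> (S ^^ n) (g z) \<in> D"
        using commute[OF shift.hyps(2)] by (simp add: D'_def)
      then show "of_bool ((S ^^ n) z \<in> D' \<and> infnorm (F n z - q) \<le> r) * u (g ((S ^^ n) z))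
          \<le> of_bool ((S ^^ n) (g z) \<in> D \<and> infnorm (F n (g z) - (q - p z)) \<le> r + R')
            * u ((S ^^ n) (g z))"
        using near[of n] u0[of "(S ^^ n) (g z)"] commute[OF shift.hyps(2), of n z]
        by (auto simp: of_bool_def)
    qed
    also have "\<dots> \<le> c * (r + R' + R) ^ d"
      using J gz R' by (intro DR) auto
    finally show ?thesis
      by (simp add: add.assoc)
  qed
  ultimately show ?case
    using D' R R' by (intro bexI[of _ D'] exI[of _ "R' + R"]) auto
next
  case (midpoint u v)
  obtain D1 R1 where D1 [measurable]: "D1 \<in> sets M"
    and R1: "R1 \<ge> 0" "prob (space M - D1) < e / 2"
    and DR1: "\<And>J z q r. finite J \<Longrightarrow> z \<in> space M \<Longrightarrow> r \<ge> s \<Longrightarrow>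
      (\<Sum>n\<in>J. of_bool ((S ^^ n) z \<in> D1 \<and> infnorm (F n z - q) \<le> r) * u ((S ^^ n) z))
        \<le> c * (r + R1) ^ d"
    using midpoint.IH(1)[of "e / 2"] midpoint.prems by auto
  obtain D2 R2 where D2 [measurable]: "D2 \<in> sets M"
    and R2: "R2 \<ge> 0" "prob (space M - D2) < e / 2"
    and DR2: "\<And>J z q r. finite J \<Longrightarrow> z \<in> space M \<Longrightarrow> r \<ge> s \<Longrightarrow>
      (\<Sum>n\<in>J. of_bool ((S ^^ n) z \<in> D2 \<and> infnorm (F n z - q) \<le> r) * v ((S ^^ n) z))
        \<le> c * (r + R2) ^ d"
    using midpoint.IH(2)[of "e / 2"] midpoint.prems by auto
  have "prob (space M - D1 \<inter> D2) \<le> prob (space M - D1) + prob (space M - D2)"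
    unfolding Diff_Int by (intro measure_Un_le) auto
  then have "prob (space M - D1 \<inter> D2) < e"
    using R1 R2 by linarith
  moreover have "(\<Sum>n\<in>J. of_bool ((S ^^ n) z \<in> D1 \<inter> D2 \<and> infnorm (F n z - q) \<le> r)
        * ((u ((S ^^ n) z) + v ((S ^^ n) z)) / 2)) \<le> c * (r + max R1 R2) ^ d"
    if J: "finite J" "z \<in> space M" "r \<ge> s" for J z q r
  proof -
    have uv0: "0 \<le> u z" "0 \<le> v z" for z
      using averages_bounds[OF midpoint.hyps(1) w01] averages_bounds[OF midpoint.hyps(2) w01]
      by blast+
    have "(\<Sum>n\<in>J. of_bool ((S ^^ n) z \<in> D1 \<inter> D2 \<and> infnorm (F n z - q) \<le> r)
        * ((u ((S ^^ n) z) + v ((S ^^ n) z)) / 2))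
      \<le> (\<Sum>n\<in>J. of_bool ((S ^^ n) z \<in> D1 \<and> infnorm (F n z - q) \<le> r) * u ((S ^^ n) z) / 2
          + of_bool ((S ^^ n) z \<in> D2 \<and> infnorm (F n z - q) \<le> r) * v ((S ^^ n) z) / 2)"
      using uv0 by (intro sum_mono) (auto simp: of_bool_def add_divide_distrib)
    also have "\<dots> = (\<Sum>n\<in>J. of_bool ((S ^^ n) z \<in> D1 \<and> infnorm (F n z - q) \<le> r)
          * u ((S ^^ n) z)) / 2
        + (\<Sum>n\<in>J. of_bool ((S ^^ n) z \<in> D2 \<and> infnorm (F n z - q) \<le> r) * v ((S ^^ n) z)) / 2"
      by (simp add: sum.distrib sum_divide_distrib)
    also have "\<dots> \<le> c * (r + R1) ^ d / 2 + c * (r + R2) ^ d / 2"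
      using J by (intro add_mono divide_right_mono DR1 DR2) auto
    also have "\<dots> \<le> c * (r + max R1 R2) ^ d / 2 + c * (r + max R1 R2) ^ d / 2"
      using J R1 R2 \<open>c \<ge> 0\<close> \<open>s \<ge> 0\<close>
      by (intro add_mono divide_right_mono mult_left_mono power_mono) auto
    finally show ?thesis
      by simp
  qed
  ultimately show ?case
    using D1 D2 R1 by (intro bexI[of _ "D1 \<inter> D2"] exI[of _ "max R1 R2"]) auto
qed

text \<open>Each of the \<open>k\<close> dyadic blocks contributes at least \<open>1 / 2\<close>, as
  its number of terms is half of its upper end.\<close>

lemma sum_inverse_dyadic_ge:
  assumes "Q > 0"
  shows "real k / 2 \<le> (\<Sum>n\<in>{Q..<2 ^ k * Q}. 1 / real n)"
proof (induction k)
  case (Suc k)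
  have "(1 / 2 :: real) = (\<Sum>n\<in>{2 ^ k * Q..<2 ^ Suc k * Q}. 1 / real (2 ^ Suc k * Q))"
    using assms by (simp add: field_simps)
  also have "\<dots> \<le> (\<Sum>n\<in>{2 ^ k * Q..<2 ^ Suc k * Q}. 1 / real n)"
  proof (intro sum_mono divide_left_mono)
    fix n
    assume n: "n \<in> {2 ^ k * Q..<2 ^ Suc k * Q}"
    then show "real n \<le> real (2 ^ Suc k * Q)"
      unfolding of_nat_le_iff by simp
    have "0 < 2 ^ k * Q"
      using assms by simp
    then have "0 < n"
      using n by simp
    then show "0 < real (2 ^ Suc k * Q) * real n"
      using assms by simp
  qed simp
  finally have "real (Suc k) / 2 \<le> (\<Sum>n\<in>{Q..<2 ^ k * Q}. 1 / real n)
      + (\<Sum>n\<in>{2 ^ k * Q..<2 ^ Suc k * Q}. 1 / real n)"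
    using Suc by simp
  also have "\<dots> = (\<Sum>n\<in>{Q..<2 ^ Suc k * Q}. 1 / real n)"
    using mult_le_mono1[of 1 "2 ^ k" Q] by (intro sum.atLeastLessThan_concat) auto
  finally show ?case .
qed simp

text \<open>Since \<open>S\<close> preserves the measure, requiring at time \<open>n\<close> that
  the orbit be in \<open>D\<close> with \<open>u\<close> at least \<open>h\<close> costs probability
  at most \<open>2 * c\<close>, uniformly in \<open>n\<close>. On the remaining event the summand is
  at least \<open>h\<close>; integrating the pointwise bound gives the claim.\<close>

lemma (in prob_space) expected_visits_ge:
  fixes F :: "nat \<Rightarrow> 'a \<Rightarrow> real ^ 'n::finite"
  assumes u [measurable]: "u \<in> borel_measurable M" and u01: "\<And>z. 0 \<le> u z \<and> u z \<le> 1"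
    and D [measurable]: "D \<in> sets M" and F [measurable]: "\<And>n. F n \<in> borel_measurable M"
    and S: "measure_preserving M S" and "h \<ge> 0" "finite J"
    and small: "prob {z \<in> space M. u z < h} \<le> c" "prob (space M - D) \<le> c"
    and bound: "\<And>z. z \<in> space M \<Longrightarrow>
      (\<Sum>n\<in>J. of_bool ((S ^^ n) z \<in> D \<and> infnorm (F n z) \<le> r) * u ((S ^^ n) z)) \<le> b"
  shows "h * (\<Sum>n\<in>J. prob {z \<in> space M. infnorm (F n z) \<le> r} - 2 * c) \<le> b"
proof -
  have mp: "measure_preserving M (S ^^ n)" for n
    using S by (rule measure_preserving_funpow)
  have Sn [measurable]: "(S ^^ n) \<in> M \<rightarrow>\<^sub>M M" for n
    using mp by (rule measure_preserving_measurable)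
  define v where "v n z = of_bool ((S ^^ n) z \<in> D \<and> infnorm (F n z) \<le> r) * u ((S ^^ n) z)" for n z
  have [measurable]: "v n \<in> borel_measurable M" for n
    unfolding v_def by measurable
  have int: "integrable M (v n)" for n
    using u01 by (intro integrable_const_bound[where B = 1]) (auto simp: v_def)
  have "h * (prob {z \<in> space M. infnorm (F n z) \<le> r} - 2 * c) \<le> expectation (v n)" for n
  proof -
    define A where "A = {z \<in> space M. (S ^^ n) z \<in> D \<and> h \<le> u ((S ^^ n) z) \<and> infnorm (F n z) \<le> r}"
    define B1 where "B1 = {z \<in> space M. (S ^^ n) z \<in> space M - D}"
    define B2 where "B2 = {z \<in> space M. (S ^^ n) z \<in> {z \<in> space M. u z < h}}"
    have [measurable]: "A \<in> sets M" "B1 \<in> sets M" "B2 \<in> sets M"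
      unfolding A_def B1_def B2_def by measurable
    have "prob {z \<in> space M. infnorm (F n z) \<le> r} \<le> prob (A \<union> (B1 \<union> B2))"
      using measurable_space[OF Sn]
      by (intro finite_measure_mono) (auto simp: A_def B1_def B2_def)
    also have "\<dots> \<le> prob A + (prob B1 + prob B2)"
      by (intro order_trans[OF measure_Un_le] add_mono order_refl) auto
    also have "prob B1 = prob (space M - D)"
      unfolding B1_def by (intro measure_preserving_measure mp) auto
    also have "prob B2 = prob {z \<in> space M. u z < h}"
      unfolding B2_def by (intro measure_preserving_measure mp) auto
    finally have "prob {z \<in> space M. infnorm (F n z) \<le> r} - 2 * c \<le> prob A"
      using small by linarith
    then have "h * (prob {z \<in> space M. infnorm (F n z) \<le> r} - 2 * c) \<le> h * prob A"
      using \<open>h \<ge> 0\<close> by (rule mult_left_mono)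
    also have "\<dots> = expectation (\<lambda>z. h * indicator A z)"
      by simp
    also have "\<dots> \<le> expectation (v n)"
    proof (rule integral_mono)
      show "h * indicator A z \<le> v n z" for z
        using u01 by (auto simp: v_def A_def indicator_def)
    qed (simp_all add: int emeasure_eq_measure)
    finally show ?thesis .
  qed
  then have "h * (\<Sum>n\<in>J. prob {z \<in> space M. infnorm (F n z) \<le> r} - 2 * c)
      \<le> (\<Sum>n\<in>J. expectation (v n))"
    unfolding sum_distrib_left by (rule sum_mono)
  also have "\<dots> = expectation (\<lambda>z. \<Sum>n\<in>J. v n z)"
    using int by simp
  also have "\<dots> \<le> expectation (\<lambda>_. b)"
    using bound by (intro integral_mono Bochner_Integration.integrable_sum int) (auto simp: v_def)
  finally show ?thesis
    by (simp add: prob_space)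
qed

lemma liminf_eq_0I:
  fixes a :: "nat \<Rightarrow> real"
  assumes "\<And>n. 0 \<le> a n" and small: "\<And>N k. \<exists>n\<ge>N. a n \<le> 1 / real (Suc k)"
  shows "liminf (\<lambda>n. ereal (a n)) = 0"
proof (rule antisym)
  show "0 \<le> liminf (\<lambda>n. ereal (a n))"
    using assms(1) by (intro Liminf_bounded) simp
  show "liminf (\<lambda>n. ereal (a n)) \<le> 0"
  proof (rule ccontr)
    assume "\<not> liminf (\<lambda>n. ereal (a n)) \<le> 0"
    then obtain c where c: "0 < ereal c" "ereal c < liminf (\<lambda>n. ereal (a n))"
      using ereal_dense2[of 0 "liminf (\<lambda>n. ereal (a n))"] by (auto simp: not_le)
    then have "eventually (\<lambda>n. c < a n) sequentially"
      using less_LiminfD[OF c(2)] by simp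
    then obtain N where N: "\<And>n. n \<ge> N \<Longrightarrow> c < a n"
      by (auto simp: eventually_sequentially)
    obtain k where "1 / real (Suc k) < c"
      using c(1) nat_approx_posE[of c] by auto
    then show False
      using small[of N k] N by (meson less_imp_le_nat not_le order_trans order_less_trans)
  qed
qed

section \<open>Algebraic identities for cocycles\<close>

lemma funpow_pair_map:
  fixes S :: "'a \<Rightarrow> 'a" and T :: "'b \<Rightarrow> 'b"
  shows "((\<lambda>(x, y). (S x, T y)) ^^ n) z = ((S ^^ n) (fst z), (T ^^ n) (snd z))"
  by (induction n) (auto simp: split_beta)

lemma cocycle_difference:
  "cocycle (\<lambda>(x, y). (T x, T y)) (\<lambda>(x, y). f x - f y) n z
    = cocycle T f n (fst z) - (cocycle T f n (snd z) :: 'b::ab_group_add)"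
  by (simp add: cocycle_def funpow_pair_map sum_subtractf)

lemma cocycle_add:
  "cocycle T f (m + n) x = cocycle T f n x + cocycle T f m ((T ^^ n) x)"
  by (induction m) (auto simp: cocycle_def funpow_add add.assoc)

text \<open>The sums started at \<open>x\<close> and at \<open>T x\<close> differ only in their end
  terms. This is the source of the coboundaries with transfer functions \<open>f\<close> and
  \<open>- f\<close> for the two coordinate maps.\<close>

lemma cocycle_shift:
  "cocycle T f n (T x) = cocycle T f n x + f ((T ^^ n) x) - (f x :: 'b::ab_group_add)"
  by (induction n) (auto simp: cocycle_def funpow_swap1)

subsection \<open>Recurrence of the difference cocycle\<close>

text \<open>The bound \<open>conc\<close> is the common consequence of the two alternative
  hypotheses of the theorem.\<close>

lemma recurrent_difference:
  fixes M :: "'a measure" and f :: "'a \<Rightarrow> real ^ 'n::finite"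
  assumes "prob_space M" and T: "measure_preserving M T" and "ergodic M T"
    and f [measurable]: "f \<in> borel_measurable M" and "e > 0" "K > 0"
    and conc: "\<And>n. n \<ge> 1 \<Longrightarrow>
      measure M {x \<in> space M. infnorm (cocycle T f n x) \<le> K * real n powr (1 / real CARD('n))} \<ge> e"
  shows "recurrent (M \<Otimes>\<^sub>M M) (\<lambda>(x, y). (T x, T y)) (\<lambda>(x, y). f x - f y)"
proof (rule ccontr)
  assume not_rec: "\<not> recurrent (M \<Otimes>\<^sub>M M) (\<lambda>(x, y). (T x, T y)) (\<lambda>(x, y). f x - f y)"
  interpret prob_space M by fact
  interpret P: pair_prob_space M M ..
  let ?P = "M \<Otimes>\<^sub>M M"
  define d where "d = CARD('n)"
  have "d > 0"
    by (simp add: d_def)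
  have [measurable]: "(T ^^ n) \<in> M \<rightarrow>\<^sub>M M" for n
    using T by (intro measure_preserving_measurable measure_preserving_funpow)
  have [measurable]: "(\<lambda>x. cocycle T f n x) \<in> borel_measurable M" for n
    unfolding cocycle_def by measurable
  define S where "S = (\<lambda>(x, y). (T x, T y))"
  define g1 where "g1 = (\<lambda>(x, y). (T x, y :: 'a))"
  define g2 where "g2 = (\<lambda>(x :: 'a, y). (x, T y))"
  have S: "measure_preserving ?P S"
    unfolding S_def by (intro measure_preserving_pair assms)
  have g12: "measure_preserving ?P g" if "g \<in> {g1, g2}" for g
    using that measure_preserving_pair[OF \<open>prob_space M\<close> T measure_preserving_id]
      measure_preserving_pair[OF \<open>prob_space M\<close> measure_preserving_id T]
    by (auto simp: g1_def g2_def)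
  have S_pow: "(S ^^ n) z = ((T ^^ n) (fst z), (T ^^ n) (snd z))" for n z
    unfolding S_def by (rule funpow_pair_map)
  define F where "F n z = cocycle T f n (fst z) - cocycle T f n (snd z)" for n z
  have [measurable]: "F n \<in> borel_measurable ?P" for n
    unfolding F_def by measurable
  have F_add: "F (m + n) z = F n z + F m ((S ^^ n) z)" for m n z
    by (simp add: F_def S_pow cocycle_add)

  \<comment> \<open>Countably many thresholds suffice: if every \<open>C N k\<close> were null,
    almost every point would avoid all of them and have lower limit 0.\<close>
  define C where "C N k = {z \<in> space ?P. \<forall>n\<ge>N. infnorm (F n z) > 1 / real (Suc k)}" for N k
  have C_sets [measurable]: "C N k \<in> sets ?P" for N k
    unfolding C_def by measurable
  have "\<exists>N k. P.prob (C N k) > 0"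
  proof (rule ccontr)
    assume "\<not> (\<exists>N k. P.prob (C N k) > 0)"
    then have "P.prob (C N k) = 0" for N k
      by (simp add: not_less measure_le_0_iff)
    then have "AE z in ?P. z \<notin> C N k" for N k
      using P.prob_eq_0[OF C_sets] by simp
    then have "AE z in ?P. \<forall>N k. z \<notin> C N k"
      by (simp add: AE_all_countable)
    then have "AE z in ?P. liminf (\<lambda>n. ereal (infnorm (F n z))) = 0"
      using AE_space
    proof eventually_elim
      case (elim z)
      have "\<exists>n\<ge>N. infnorm (F n z) \<le> 1 / real (Suc k)" for N k
        using elim by (auto simp: C_def not_less)
      then show ?case
        by (intro liminf_eq_0I infnorm_pos_le)
    qed
    then show False
      using not_rec by (simp add: recurrent_def cocycle_difference maxnorm_eq_infnorm F_def)
  qed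
  then obtain N k0 where Npos: "P.prob (C N k0) > 0"
    by blast
  define s where "s = 1 / real (Suc k0)"
  have "s > 0"
    by (simp add: s_def)
  define C0 where "C0 = C N k0"
  have C0_sets [measurable]: "C0 \<in> sets ?P"
    by (simp add: C0_def)
  have C0: "infnorm (F n z) > s" if "z \<in> C0" "n \<ge> N" for n z
    using that by (simp add: C0_def C_def s_def)
  \<comment> \<open>Half the measure of \<open>C0\<close> lies strictly below the mean of
    \<open>w\<close>, as \<open>averages_concentrate\<close> demands.\<close>
  define h where "h = P.prob C0 / 2"
  have "h > 0"
    using Npos by (simp add: h_def C0_def)
  define w where "w = (indicator C0 :: 'a \<times> 'a \<Rightarrow> real)"
  have w: "w \<in> borel_measurable ?P" and w01: "0 \<le> w z \<and> w z \<le> 1" for z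
    by (simp_all add: w_def indicator_def)
  \<comment> \<open>For \<open>r \<ge> s\<close> the cell count \<open>2 * r / s + 2\<close> is at
    most \<open>4 / s * r\<close>.\<close>
  define c where "c = real N * (4 / s) ^ d"
  have "c \<ge> 0"
    using \<open>s > 0\<close> by (simp add: c_def)

  have visits: "(\<Sum>n\<in>J. of_bool (infnorm (F n z - q) \<le> r) * w ((S ^^ n) z)) \<le> c * r ^ d"
    if J: "finite J" and "r \<ge> s" for J z q r
  proof -
    define V where "V = {n \<in> J. infnorm (F n z - q) \<le> r \<and> (S ^^ n) z \<in> C0}"
    have "(\<Sum>n\<in>J. of_bool (infnorm (F n z - q) \<le> r) * w ((S ^^ n) z)) = (\<Sum>n\<in>J. of_bool (n \<in> V))"
      by (intro sum.cong) (auto simp: V_def w_def)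
    also have "\<dots> = real (card V)"
    proof -
      have "J \<inter> {n. n \<in> V} = V"
        by (auto simp: V_def)
      then show ?thesis
        using J by simp
    qed
    also have "\<dots> \<le> real N * (2 * r / s + 2) ^ CARD('n)"
    proof (rule card_separated_le)
      show "infnorm (F n z - F m z) > s" if "m \<in> V" "n \<in> V" "m + N \<le> n" for m n
      proof -
        have "F n z - F m z = F (n - m) ((S ^^ m) z)"
          using F_add[of "n - m" m z] that by simp
        then show ?thesis
          using C0[of "(S ^^ m) z" "n - m"] that by (simp add: V_def)
      qed
    qed (use J \<open>s > 0\<close> \<open>r \<ge> s\<close> in \<open>auto simp: V_def\<close>)
    also have "\<dots> \<le> real N * (4 / s * r) ^ d"
      unfolding d_def using \<open>s > 0\<close> \<open>r \<ge> s\<close>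
      by (intro mult_left_mono power_mono) (auto simp: field_simps)
    finally show ?thesis
      by (simp only: c_def power_mult_distrib mult.assoc)
  qed

  have ergodic_pair: "P.prob A = 0 \<or> P.prob A = 1"
    if "A \<in> sets ?P" and inv: "\<And>g. g \<in> {g1, g2} \<Longrightarrow> AE z in ?P. g z \<in> A \<longleftrightarrow> z \<in> A" for A
    using inv[of g1] inv[of g2] that(1)
    by (intro ergodic_pair_AE_invariant[OF assms(1-3)]) (auto simp: g1_def g2_def split_beta)
  have cohom: "\<exists>p\<in>borel_measurable ?P. \<forall>n z. F n (g z) = F n z + p ((S ^^ n) z) - p z"
    if "g \<in> {g1, g2}" for g
  proof (cases "g = g1")
    case True
    then show ?thesis
      by (intro bexI[of _ "\<lambda>z. f (fst z)"]) (auto simp: F_def g1_def S_pow cocycle_shift)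
  next
    case False
    then show ?thesis
      using that
      by (intro bexI[of _ "\<lambda>z. - f (snd z)"]) (auto simp: F_def g2_def S_pow cocycle_shift)
  qed
  have commute: "(S ^^ n) (g z) = g ((S ^^ n) z)" if "g \<in> {g1, g2}" for g n z
    using that by (auto simp: S_pow g1_def g2_def split_beta funpow_swap1)
  have S_space: "(S ^^ n) z \<in> space ?P" if "z \<in> space ?P" for n z
    using measurable_space[OF measure_preserving_measurable[OF measure_preserving_funpow[OF S]] that] .

  define b where "b = e\<^sup>2 / (2 * K + 2) ^ d"
  have "b > 0"
    using \<open>e > 0\<close> \<open>K > 0\<close> by (simp add: b_def)
  have lower: "P.prob {z \<in> space ?P. infnorm (F n z) \<le> r} \<ge> b * real Q / real n"
    if "Q \<ge> 1" "n \<ge> Q" and r: "r = real Q powr (1 / real d)" for Q n r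
  proof -
    \<comment> \<open>This is the \<open>d\<close>-th root of \<open>n / Q\<close>. As
      \<open>t \<ge> 1\<close>, the base \<open>2 * K * t + 2\<close> of the cell count is at most
      \<open>(2 * K + 2) * t\<close>, whose \<open>d\<close>-th power produces
      \<open>b * Q / n\<close>.\<close>
    define t where "t = real n powr (1 / real d) / r"
    have "r > 0"
      using that by simp
    have root: "(x powr (1 / real d)) ^ d = x" if "x > 0" for x :: real
      using that \<open>d > 0\<close> by (simp add: powr_power)
    have "r \<le> real n powr (1 / real d)"
      unfolding r using that by (intro powr_mono2) auto
    then have "t \<ge> 1"
      using \<open>r > 0\<close> by (simp add: t_def)
    have "t ^ d = real n / real Q"
      using that root[of "real n"] root[of "real Q"] by (simp add: t_def power_divide)
    have "b * real Q / real n = e\<^sup>2 / ((2 * K + 2) * t) ^ d"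
      using that by (simp add: b_def power_mult_distrib \<open>t ^ d = real n / real Q\<close>)
    also have "\<dots> \<le> e\<^sup>2 / (2 * (K * real n powr (1 / real d)) / r + 2) ^ d"
    proof -
      have "2 * (K * real n powr (1 / real d)) / r + 2 = 2 * K * t + 2"
        by (simp add: t_def)
      also have "\<dots> \<le> (2 * K + 2) * t"
        using \<open>t \<ge> 1\<close> by (simp add: algebra_simps)
      finally show ?thesis
        using \<open>t \<ge> 1\<close> \<open>K > 0\<close> \<open>r > 0\<close>
        by (intro divide_left_mono power_mono mult_pos_pos zero_less_power add_nonneg_pos) auto
    qed
    also have "\<dots> \<le> P.prob {z \<in> space ?P. infnorm (F n z) \<le> r}"
      unfolding F_def d_def
      using \<open>prob_space M\<close> \<open>r > 0\<close> \<open>K > 0\<close> \<open>e > 0\<close> conc[of n] that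
      by (intro prob_independent_difference_ge) auto
    finally show ?thesis .
  qed

  have main: "h * b * real k \<le> 4 * c * 2 ^ d" if "k \<ge> 1" for k :: nat
  proof -
    \<comment> \<open>The loss \<open>2 * a\<close> per time, over fewer than
      \<open>2 ^ k * Q\<close> times, costs at most half of the harmonic gain
      \<open>b * Q * k / 2\<close>. As \<open>a\<close> does not involve \<open>Q\<close>, the data
      \<open>u\<close>, \<open>D\<close> and \<open>R\<close> can be fixed before
      \<open>Q\<close>.\<close>
    define a where "a = b * real k / (8 * 2 ^ k)"
    have "a > 0"
      using \<open>b > 0\<close> that by (simp add: a_def)
    have "h < P.expectation w"
      using \<open>h > 0\<close> by (simp add: w_def h_def)
    then obtain u where u: "u \<in> averages {g1, g2} w"
      and u_small: "P.prob {z \<in> space ?P. u z < h} < a"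
      using P.averages_concentrate[OF w w01 g12 ergodic_pair _ \<open>a > 0\<close>] by blast
    obtain D R where D: "D \<in> sets ?P" and R: "R \<ge> 0" "P.prob (space ?P - D) < a"
      and DR: "\<And>J z q r. finite J \<Longrightarrow> z \<in> space ?P \<Longrightarrow> r \<ge> s \<Longrightarrow>
        (\<Sum>n\<in>J. of_bool ((S ^^ n) z \<in> D \<and> infnorm (F n z - q) \<le> r) * u ((S ^^ n) z))
          \<le> c * (r + R) ^ d"
      using P.averages_visits_le[OF w01 g12 commute cohom S_space \<open>c \<ge> 0\<close> less_imp_le[OF \<open>s > 0\<close>]
          visits u \<open>a > 0\<close>] by blast
    \<comment> \<open>Chosen after \<open>R\<close>, so that the radius \<open>r\<close> dominates
      both \<open>s\<close> and the displacement \<open>R\<close>. Then \<open>(r + R) ^ d\<close>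
      is at most \<open>2 ^ d * Q\<close>, and the factor \<open>Q\<close> cancels in the
      end.\<close>
    obtain Q :: nat where Q: "real Q \<ge> max 1 ((max R s) ^ d)"
      using real_arch_simple by blast
    then have "Q \<ge> 1" "real Q \<ge> (max R s) ^ d"
      by auto
    define r where "r = real Q powr (1 / real d)"
    have rd: "r ^ d = real Q"
      using \<open>Q \<ge> 1\<close> \<open>d > 0\<close> by (simp add: r_def powr_power)
    have "max R s \<le> r"
    proof (rule power_le_imp_le_base)
      \<comment> \<open>The exponent \<open>d\<close> is written as a successor to match
        \<open>power_le_imp_le_base\<close>.\<close>
      show "max R s ^ Suc (d - 1) \<le> r ^ Suc (d - 1)"
        using \<open>d > 0\<close> rd \<open>real Q \<ge> (max R s) ^ d\<close> by simp
    qed (simp add: r_def)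
    define J where "J = {Q..<2 ^ k * Q}"
    have "b * real Q * real k / 4 = b * real Q * (real k / 2) - 2 * a * real (2 ^ k * Q)"
      by (simp add: a_def field_simps)
    also have "\<dots> \<le> b * real Q * (\<Sum>n\<in>J. 1 / real n) - 2 * a * real (card J)"
    proof (intro diff_mono mult_left_mono)
      show "real k / 2 \<le> (\<Sum>n\<in>J. 1 / real n)"
        unfolding J_def using \<open>Q \<ge> 1\<close> by (intro sum_inverse_dyadic_ge) simp
      show "real (card J) \<le> real (2 ^ k * Q)"
        unfolding of_nat_le_iff by (simp add: J_def)
    qed (use \<open>a > 0\<close> \<open>b > 0\<close> in auto)
    also have "\<dots> = (\<Sum>n\<in>J. b * real Q / real n - 2 * a)"
      by (simp add: sum_subtractf sum_distrib_left)
    also have "\<dots> \<le> (\<Sum>n\<in>J. P.prob {z \<in> space ?P. infnorm (F n z) \<le> r} - 2 * a)"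
      using lower[OF \<open>Q \<ge> 1\<close> _ r_def] by (intro sum_mono diff_mono) (auto simp: J_def)
    finally have "h * (b * real Q * real k / 4)
        \<le> h * (\<Sum>n\<in>J. P.prob {z \<in> space ?P. infnorm (F n z) \<le> r} - 2 * a)"
      using \<open>h > 0\<close> by (intro mult_left_mono) auto
    also have "\<dots> \<le> c * (r + R) ^ d"
    proof (rule P.expected_visits_ge)
      show "u \<in> borel_measurable ?P"
        using u w g12 by (blast intro: averages_measurable measure_preserving_measurable)
      show "0 \<le> u z \<and> u z \<le> 1" for z
        using u w01 by (rule averages_bounds)
      show "(\<Sum>n\<in>J. of_bool ((S ^^ n) z \<in> D \<and> infnorm (F n z) \<le> r) * u ((S ^^ n) z))
          \<le> c * (r + R) ^ d" if "z \<in> space ?P" for z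
        using DR[of J z r 0] that \<open>max R s \<le> r\<close> by (simp add: J_def)
    qed (use D S u_small R \<open>h > 0\<close> in \<open>auto simp: J_def\<close>)
    also have "\<dots> \<le> c * (2 * r) ^ d"
      using \<open>c \<ge> 0\<close> \<open>max R s \<le> r\<close> R \<open>s > 0\<close> by (intro mult_left_mono power_mono) auto
    also have "\<dots> = c * 2 ^ d * real Q"
      by (simp add: power_mult_distrib rd)
    finally have "(h * b * real k / 4) * real Q \<le> (c * 2 ^ d) * real Q"
      by (simp add: algebra_simps)
    then have "h * b * real k / 4 \<le> c * 2 ^ d"
      using \<open>Q \<ge> 1\<close> by (subst (asm) mult_le_cancel_right) auto
    then show ?thesis
      by simp
  qed
  have "h * b > 0"
    using \<open>h > 0\<close> \<open>b > 0\<close> by simp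
  then obtain k :: nat where "4 * c * 2 ^ d < real k * (h * b)"
    using reals_Archimedean3 by blast
  \<comment> \<open>Passing to \<open>Suc k\<close> meets the condition \<open>k \<ge> 1\<close> of
    \<open>main\<close>.\<close>
  then have "4 * c * 2 ^ d < h * b * real (Suc k)"
    using \<open>h * b > 0\<close> by (simp add: algebra_simps)
  then show False
    using main[of "Suc k"] by simp
qed

text \<open>Tightness at the single level \<open>1 / 2\<close> gives a compact, hence bounded, set
  carrying more than half of every distribution.\<close>

lemma uniformly_tight_imp_concentrated:
  fixes g :: "nat \<Rightarrow> 'a \<Rightarrow> real ^ 'n::finite"
  assumes "prob_space M" and meas: "\<And>n. g n \<in> borel_measurable M" and tight: "uniformly_tight M g"
  shows "\<exists>e>0. \<exists>K>0. \<forall>n\<ge>1. measure M {x \<in> space M. maxnorm (g n x) \<le> K} > e"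
proof -
  interpret prob_space M by fact
  obtain C where "compact C" and C: "\<And>n. n \<ge> 1 \<Longrightarrow> measure (distr M borel (g n)) C > 1 - 1 / 2"
    using tight[unfolded uniformly_tight_def, rule_format, of "1 / 2"] by auto
  obtain K where "K > 0" and K: "\<And>v. v \<in> C \<Longrightarrow> norm v \<le> K"
    using compact_imp_bounded[OF \<open>compact C\<close>] by (auto simp: bounded_pos)
  have "prob {x \<in> space M. maxnorm (g n x) \<le> K} > 1 / 2" if "n \<ge> 1" for n
  proof -
    have [measurable]: "g n \<in> borel_measurable M"
      by (rule meas)
    have "1 / 2 < prob (g n -` C \<inter> space M)"
      using C[OF that] \<open>compact C\<close> by (simp add: measure_distr borel_compact)
    also have "\<dots> \<le> prob {x \<in> space M. maxnorm (g n x) \<le> K}"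
      unfolding maxnorm_eq_infnorm
      using K infnorm_le_norm order_trans by (intro finite_measure_mono) (blast, measurable)
    finally show ?thesis .
  qed
  then show ?thesis
    using \<open>K > 0\<close> by (intro exI[of _ "1 / 2"] conjI exI[of _ K]) auto
qed

theorem theorem14:
  fixes M :: "'a::polish_space measure"
    and T :: "'a \<Rightarrow> 'a"
    and f :: "'a \<Rightarrow> real ^ 'n::finite"
  assumes "prob_space M"
    and "sets M = sets (borel :: 'a measure)"
    and "mp_automorphism M T"
    and "ergodic M T"
    and "f \<in> borel_measurable M"
    and "uniformly_tight M (\<lambda>n x. cocycle T f n x /\<^sub>R (real n powr (1 / real CARD('n))))
         \<or> (\<exists>e>0. \<exists>K>0. \<forall>n\<ge>1.
              measure M {x \<in> space M.
                 maxnorm (cocycle T f n x /\<^sub>R (real n powr (1 / real CARD('n)))) \<le> K} > e)"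
  shows "recurrent (M \<Otimes>\<^sub>M M) (\<lambda>(x, y). (T x, T y)) (\<lambda>(x, y). f x - f y)"
proof -
  interpret prob_space M by fact
  have T: "measure_preserving M T"
    using assms(3) by (simp add: mp_automorphism_def)
  have [measurable]: "(T ^^ n) \<in> M \<rightarrow>\<^sub>M M" for n
    using T by (intro measure_preserving_measurable measure_preserving_funpow)
  note [measurable] = assms(5)
  let ?g = "\<lambda>n x. cocycle T f n x /\<^sub>R (real n powr (1 / real CARD('n)))"
  have "?g n \<in> borel_measurable M" for n
    unfolding cocycle_def by measurable
  then obtain e K where "e > 0" "K > 0"
    and eK: "\<And>n. n \<ge> 1 \<Longrightarrow> prob {x \<in> space M. maxnorm (?g n x) \<le> K} > e"
    using assms(6) uniformly_tight_imp_concentrated[OF assms(1), of ?g] by meson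
  show ?thesis
  proof (rule recurrent_difference[OF assms(1) T assms(4,5) \<open>e > 0\<close> \<open>K > 0\<close>])
    fix n :: nat
    assume "n \<ge> 1"
    \<comment> \<open>The scaling factor is positive because \<open>n \<ge> 1\<close>, so it can be
      moved across the inequality.\<close>
    then have "maxnorm (?g n x) \<le> K \<longleftrightarrow>
        infnorm (cocycle T f n x) \<le> K * real n powr (1 / real CARD('n))" for x
      by (simp add: maxnorm_eq_infnorm infnorm_mul field_simps)
    then show "e \<le> prob {x \<in> space M.
        infnorm (cocycle T f n x) \<le> K * real n powr (1 / real CARD('n))}"
      using eK[OF \<open>n \<ge> 1\<close>] by simp
  qed
qed

end
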